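(* Every regular embedding $|\psi\rangle$ of the randomized one-out-of-two oblivious transfer $P^{\mathrm{OT}}_{X,Y}$ has leakage $\Delta_\psi(P^{\mathrm{OT}}_{X,Y})\ge\tfrac12$. Among regular embeddings, the leakage is minimized by the canonical embedding.
   Context: $P^{\mathrm{OT}}_{X,Y}$ is the distribution with Alice's output $X=(x_0,x_1)\in\{0,1\}^2$ and Bob's output $Y=(c,y)\in\{0,1\}^2$, $P((x_0,x_1),(c,y))=\tfrac18$ if $y=x_c$ and $0$ otherwise. A regular embedding of a distribution $P_{X,Y}$ is a state $\sum_{x,y}e^{i\theta(x,y)}\sqrt{P_{X,Y}(x,y)}|x\rangle_A|y\rangle_B$ for a real function $\theta$ (computational bases indexed by outcomes); the canonical embedding has $\theta\equiv0$. Its leakage is $\Delta_\psi(P_{X,Y})=\max\{S(X;B)-I(X;Y),\,S(A;Y)-I(X;Y)\}$, where $X$ (resp. $Y$) is the outcome of measuring $A$ (resp. $B$) in the computational basis, $S(X;B)$ is the quantum mutual information $S(X)+S(B)-S(XB)$ (von Neumann entropy) of the state after measuring $A$, and similarly for $S(A;Y)$; $I$ is Shannon mutual information. *)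

theory Defs
  imports "Jordan_Normal_Form.Char_Poly" "HOL-Computational_Algebra.Polynomial"
begin

definition eta :: "real \<Rightarrow> real" where
  "eta p = (if p = 0 then 0 else - p * log 2 p)"

text \<open>von Neumann entropy (in bits) of a density matrix: sum of eta over the
  eigenvalues, counted with algebraic multiplicity (roots of the characteristic
  polynomial).  Density matrices are Hermitian, so eigenvalues are real.\<close>
definition vn_entropy :: "complex mat \<Rightarrow> real" where
  "vn_entropy \<rho> = sum_mset (image_mset (\<lambda>\<mu>. eta (Re \<mu>)) (proots (char_poly \<rho>)))"

definition shannon :: "nat \<Rightarrow> (nat \<Rightarrow> real) \<Rightarrow> real" where
  "shannon n p = (\<Sum>i<n. eta (p i))"

text \<open>A bipartite pure state on C^dA (x) C^dB is given by its amplitudes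
  psi x y on the computational basis |x>_A|y>_B, x < dA, y < dB.
  Joint index of |x>|y> is x*dB + y.\<close>

definition prob_XY :: "(nat \<Rightarrow> nat \<Rightarrow> complex) \<Rightarrow> nat \<Rightarrow> nat \<Rightarrow> real" where
  "prob_XY psi x y = (cmod (psi x y))\<^sup>2"

definition shannon_MI :: "nat \<Rightarrow> nat \<Rightarrow> (nat \<Rightarrow> nat \<Rightarrow> real) \<Rightarrow> real" where
  "shannon_MI dA dB P =
     shannon dA (\<lambda>x. \<Sum>y<dB. P x y) + shannon dB (\<lambda>y. \<Sum>x<dA. P x y)
     - shannon (dA * dB) (\<lambda>k. P (k div dB) (k mod dB))"

definition rho_B :: "nat \<Rightarrow> nat \<Rightarrow> (nat \<Rightarrow> nat \<Rightarrow> complex) \<Rightarrow> complex mat" where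
  "rho_B dA dB psi = mat dB dB (\<lambda>(y, y'). \<Sum>x<dA. psi x y * cnj (psi x y'))"

definition rho_A :: "nat \<Rightarrow> nat \<Rightarrow> (nat \<Rightarrow> nat \<Rightarrow> complex) \<Rightarrow> complex mat" where
  "rho_A dA dB psi = mat dA dA (\<lambda>(x, x'). \<Sum>y<dB. psi x y * cnj (psi x' y))"

text \<open>Classical-quantum state after measuring A in the computational basis:
  sum_x |x><x| (x) (B-part), on index x*dB+y.\<close>
definition rho_XB :: "nat \<Rightarrow> nat \<Rightarrow> (nat \<Rightarrow> nat \<Rightarrow> complex) \<Rightarrow> complex mat" where
  "rho_XB dA dB psi = mat (dA * dB) (dA * dB) (\<lambda>(i, j).
     if i div dB = j div dB then psi (i div dB) (i mod dB) * cnj (psi (j div dB) (j mod dB)) else 0)"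

text \<open>Quantum-classical state after measuring B in the computational basis:
  sum_y (A-part) (x) |y><y|, on index x*dB+y.\<close>
definition rho_AY :: "nat \<Rightarrow> nat \<Rightarrow> (nat \<Rightarrow> nat \<Rightarrow> complex) \<Rightarrow> complex mat" where
  "rho_AY dA dB psi = mat (dA * dB) (dA * dB) (\<lambda>(i, j).
     if i mod dB = j mod dB then psi (i div dB) (i mod dB) * cnj (psi (j div dB) (j mod dB)) else 0)"

definition rho_X :: "nat \<Rightarrow> nat \<Rightarrow> (nat \<Rightarrow> nat \<Rightarrow> complex) \<Rightarrow> complex mat" where
  "rho_X dA dB psi = mat dA dA (\<lambda>(x, x'). if x = x' then \<Sum>y<dB. psi x y * cnj (psi x y) else 0)"

definition rho_Y :: "nat \<Rightarrow> nat \<Rightarrow> (nat \<Rightarrow> nat \<Rightarrow> complex) \<Rightarrow> complex mat" where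
  "rho_Y dA dB psi = mat dB dB (\<lambda>(y, y'). if y = y' then \<Sum>x<dA. psi x y * cnj (psi x y) else 0)"

definition qMI_XB :: "nat \<Rightarrow> nat \<Rightarrow> (nat \<Rightarrow> nat \<Rightarrow> complex) \<Rightarrow> real" where
  "qMI_XB dA dB psi = vn_entropy (rho_X dA dB psi) + vn_entropy (rho_B dA dB psi)
      - vn_entropy (rho_XB dA dB psi)"

definition qMI_AY :: "nat \<Rightarrow> nat \<Rightarrow> (nat \<Rightarrow> nat \<Rightarrow> complex) \<Rightarrow> real" where
  "qMI_AY dA dB psi = vn_entropy (rho_A dA dB psi) + vn_entropy (rho_Y dA dB psi)
      - vn_entropy (rho_AY dA dB psi)"

definition leakage :: "nat \<Rightarrow> nat \<Rightarrow> (nat \<Rightarrow> nat \<Rightarrow> complex) \<Rightarrow> real" where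
  "leakage dA dB psi =
     max (qMI_XB dA dB psi - shannon_MI dA dB (prob_XY psi))
         (qMI_AY dA dB psi - shannon_MI dA dB (prob_XY psi))"

definition regular_embedding ::
  "(nat \<Rightarrow> nat \<Rightarrow> real) \<Rightarrow> (nat \<Rightarrow> nat \<Rightarrow> real) \<Rightarrow> nat \<Rightarrow> nat \<Rightarrow> complex" where
  "regular_embedding \<theta> P x y = exp (\<i> * complex_of_real (\<theta> x y)) * complex_of_real (sqrt (P x y))"

text \<open>Randomized 1-out-of-2 OT.  Alice's outcome (x0,x1) in {0,1}^2 is encoded as
  index x = 2*x0 + x1 < 4, Bob's outcome (c,y) as index 2*c + y < 4.
  P((x0,x1),(c,y)) = 1/8 if y = x_c, else 0.\<close>
definition bit_of :: "nat \<Rightarrow> nat \<Rightarrow> nat" where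
  "bit_of x c = (if c = 0 then x div 2 else x mod 2)"

definition P_OT :: "nat \<Rightarrow> nat \<Rightarrow> real" where
  "P_OT x b = (if x < 4 \<and> b < 4 \<and> b mod 2 = bit_of x (b div 2) then 1/8 else 0)"

end

theory Submission
  imports Defs "Jordan_Normal_Form.Schur_Decomposition"
begin

text \<open>
  In every regular embedding the measured states \<open>X\<close>, \<open>Y\<close>, \<open>XB\<close> and \<open>AY\<close> are \<open>1/4\<close> times a
  projection of rank \<open>4\<close>, so each has entropy \<open>2\<close>; since \<open>I(X;Y) = 1\<close>, the leakage is
  \<open>max (S(A)) (S(B)) - 1\<close>.  The matrix of \<open>\<rho>\<^sub>B\<close> is a weighted 4-cycle with diagonal entries \<open>1/4\<close>
  and off-diagonal entries of modulus \<open>1/8\<close>; its eigenvalues are \<open>(1 \<plusminus> c)/4\<close> and \<open>(1 \<plusminus> s)/4\<close>, where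
  \<open>c\<^sup>2 + s\<^sup>2 = 1\<close> and \<open>c\<close> depends only on the phases around the cycle.  The bound
  \<open>h(p) \<ge> 4 p (1 - p)\<close> for the binary entropy \<open>h\<close> then yields \<open>S(B) \<ge> 3/2\<close>.  The canonical
  embedding has the spectrum \<open>1/2, 1/4, 1/4, 0\<close> on both sides and attains equality.
\<close>

section \<open>Lower bounds for the binary entropy\<close>

text \<open>The lower bound is \<open>1 - p\<close> times the tangent at \<open>1/2\<close> of the convex function
  \<open>- ln p / (1 - p)\<close>.\<close>

lemma neg_ln_ge:
  fixes p :: real
  assumes "0 < p" "p \<le> 1"
  shows "(1 - p) * (2 * ln 2 + (4 * ln 2 - 4) * (p - 1/2)) \<le> - ln p"
proof -
  \<comment> \<open>\<open>m\<close> is the slope at 1/2 of \<open>- ln p / (1 - p)\<close>. The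
    difference \<open>G\<close> of the two sides has the tangency point 1/2 and \<open>r\<close> as
    its critical points.\<close>
  define m :: real where "m = 4 * ln 2 - 4"
  define r where "r = - 1 / m"
  define G where "G t = - ln t - (1 - t) * (2 * ln 2 + m * (t - 1/2))" for t :: real
  have ln2_lower: "ln 2 \<ge> (1/2 :: real)"
    using ln_le_minus_one[of "1/2 :: real"] by (simp add: ln_div)
  \<comment> \<open>Since 2 \<le> (9/8)^6, this gives ln 2 \<le> 3/4. Together with ln 2 \<ge> 1/2
    it confines \<open>m\<close> to [-2, -1], which is what puts \<open>r\<close> in
    [1/2, 1].\<close>
  have "ln (2::real) \<le> ln ((9/8) ^ 6)"
    by (subst ln_le_cancel_iff) (simp_all add: power_divide)
  also have "\<dots> = 6 * ln (9/8)"
    by (subst ln_realpow) simp_all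
  also have "\<dots> \<le> 3/4"
    using ln_le_minus_one[of "9/8 :: real"] by simp
  finally have ln2_upper: "ln 2 \<le> (3/4 :: real)" .
  have m: "m < 0" "-2 \<le> m" "m \<le> -1"
    using ln2_lower ln2_upper by (simp_all add: m_def)
  have r: "1/2 \<le> r" "r \<le> 1"
    using m by (simp_all add: r_def field_simps)
  have G_half: "G (1/2) = 0"
    by (simp add: G_def ln_div)
  have G_one: "G 1 = 0"
    by (simp add: G_def)
  have deriv: "(G has_real_derivative 2 * m * (t - 1/2) * (t - r) / t) (at t)" if "t > 0" for t
  proof -
    have mr: "m * r = -1" using m by (simp add: r_def)
    have ln2: "2 * ln 2 = m / 2 + (2::real)" by (simp add: m_def field_simps)
    have "(G has_real_derivative - (1 / t) - ((1 - t) * m - (2 * ln 2 + m * (t - 1/2)))) (at t)"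
      unfolding G_def using that by (auto intro!: derivative_eq_intros)
    moreover have "- (1 / t) - ((1 - t) * m - (2 * ln 2 + m * (t - 1/2)))
        = 2 * m * (t - 1/2) * (t - r) / t"
    proof -
      have "2 * m * (t - 1/2) * (t - r) = 2 * m * t\<^sup>2 - m * t - (2 * t - 1) * (m * r)"
        by (simp add: algebra_simps power2_eq_square)
      also have "\<dots> = t * (- (1 / t) - ((1 - t) * m - (m / 2 + 2 + m * (t - 1/2))))"
        unfolding mr using that by (simp add: field_simps power2_eq_square)
      finally show ?thesis unfolding ln2 using that by (simp add: field_simps)
    qed
    ultimately show ?thesis by simp
  qed
  \<comment> \<open>As \<open>m < 0\<close>, the factored derivative shows that \<open>G\<close>
    falls up to 1/2, rises up to \<open>r\<close> and falls again up to 1. Its zeros at 1/2 and 1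
    therefore bound it from below on each piece.\<close>
  have "G p \<ge> 0"
  proof (cases "p \<le> 1/2")
    case True
    have "G p \<ge> G (1/2)"
    proof (rule DERIV_nonpos_imp_nonincreasing[OF True])
      fix x assume x: "p \<le> x" "x \<le> 1/2"
      have "2 * m * (x - 1/2) * (x - r) / x \<le> 0"
        using x m r assms
        by (intro divide_nonpos_pos mult_nonneg_nonpos mult_nonpos_nonpos) auto
      thus "\<exists>y. (G has_real_derivative y) (at x) \<and> y \<le> 0"
        using deriv[of x] x assms by auto
    qed
    thus ?thesis by (simp add: G_half)
  next
    case half: False
    show ?thesis
    proof (cases "p \<le> r")
      case True
      have "G (1/2) \<le> G p"
      proof (rule DERIV_nonneg_imp_nondecreasing[where f = G and a = "1/2" and b = p])
        fix x assume x: "1/2 \<le> x" "x \<le> p"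
        have "2 * m * (x - 1/2) * (x - r) / x \<ge> 0"
          using x m r assms True
          by (intro divide_nonneg_pos mult_nonpos_nonpos[OF mult_nonpos_nonneg]) auto
        thus "\<exists>y. (G has_real_derivative y) (at x) \<and> y \<ge> 0"
          using deriv[of x] x by auto
      qed (use half in simp)
      thus ?thesis by (simp add: G_half)
    next
      case False
      have "G p \<ge> G 1"
      proof (rule DERIV_nonpos_imp_nonincreasing[OF assms(2)])
        fix x assume x: "p \<le> x" "x \<le> 1"
        have "2 * m * (x - 1/2) * (x - r) / x \<le> 0"
          using x m r assms half False
          by (intro divide_nonpos_pos mult_nonpos_nonneg[OF mult_nonpos_nonneg]) auto
        thus "\<exists>y. (G has_real_derivative y) (at x) \<and> y \<le> 0"
          using deriv[of x] x assms by auto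
      qed
      thus ?thesis by (simp add: G_one)
    qed
  qed
  thus ?thesis by (simp add: G_def m_def)
qed

lemma eta_0 [simp]: "eta 0 = 0"
  by (simp add: eta_def)

lemma eta_1 [simp]: "eta 1 = 0"
  by (simp add: eta_def)

lemma eta_half: "eta (p / 2) = p / 2 + eta p / 2" if "p \<ge> 0"
  using that by (simp add: eta_def log_divide field_simps)

lemma eta_quarter: "eta (1/4) = 1/2"
  using eta_half[of "1/2"] eta_half[of 1] by simp

lemma eta_eighth: "eta (1/8) = 3/8"
  using eta_half[of "1/4"] by (simp add: eta_quarter)

text \<open>Weight \<open>neg_ln_ge\<close> at \<open>p\<close> by \<open>p\<close> and at
  \<open>1 - p\<close> by \<open>1 - p\<close>, and add. Both bounds then carry the factor p (1 -
  p), and the slope terms cancel because p - 1/2 changes sign under p -> 1 - p.\<close>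

lemma binary_entropy_ge:
  fixes p :: real
  assumes "0 \<le> p" "p \<le> 1"
  shows "4 * p * (1 - p) \<le> eta p + eta (1 - p)"
proof (cases "p = 0 \<or> p = 1")
  case False
  hence p: "0 < p" "p < 1" using assms by auto
  let ?m = "4 * ln 2 - 4 :: real"
  have "p * ((1 - p) * (2 * ln 2 + ?m * (p - 1/2))) \<le> p * (- ln p)"
    using neg_ln_ge[of p] p by (intro mult_left_mono) auto
  moreover have "(1 - p) * ((1 - (1 - p)) * (2 * ln 2 + ?m * (1 - p - 1/2))) \<le> (1 - p) * (- ln (1 - p))"
    using neg_ln_ge[of "1 - p"] p by (intro mult_left_mono) auto
  ultimately have "4 * p * (1 - p) * ln 2 \<le> - p * ln p - (1 - p) * ln (1 - p)"
    by (simp add: algebra_simps)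
  hence "4 * p * (1 - p) \<le> (- p * ln p - (1 - p) * ln (1 - p)) / ln 2"
    by (simp add: pos_le_divide_eq)
  also have "\<dots> = eta p + eta (1 - p)"
    using p by (simp add: eta_def log_def diff_divide_distrib add_divide_distrib algebra_simps)
  finally show ?thesis .
qed auto

text \<open>The pair is the distribution (1 + c)/2, (1 - c)/2 scaled by 1/2. Scaling halves the
  entropy and adds 1/2, and 4 p (1 - p) = 1 - c^2 at p = (1 + c)/2.\<close>

lemma eta_pair_ge:
  fixes c :: real
  assumes "0 \<le> c" "c \<le> 1"
  shows "1 - c\<^sup>2 / 2 \<le> eta ((1 + c) / 4) + eta ((1 - c) / 4)"
proof -
  have "1 - c\<^sup>2 \<le> eta ((1 + c) / 2) + eta ((1 - c) / 2)"
    using binary_entropy_ge[of "(1 + c) / 2"] assms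
    by (simp add: field_simps power2_eq_square)
  thus ?thesis
    using eta_half[of "(1 + c) / 2"] eta_half[of "(1 - c) / 2"] assms by (simp add: field_simps)
qed

section \<open>Traces, eigenvalues and entropy\<close>

lemma trace_mult_commute:
  fixes A B :: "'a :: comm_semiring_0 mat"
  assumes "A \<in> carrier_mat n m" "B \<in> carrier_mat m n"
  shows "(\<Sum>i<n. (A * B) $$ (i, i)) = (\<Sum>j<m. (B * A) $$ (j, j))"
proof -
  have "(\<Sum>i<n. (A * B) $$ (i, i)) = (\<Sum>i<n. \<Sum>j<m. A $$ (i, j) * B $$ (j, i))"
    using assms by (intro sum.cong) (auto simp: scalar_prod_def atLeast0LessThan)
  also have "\<dots> = (\<Sum>j<m. \<Sum>i<n. B $$ (j, i) * A $$ (i, j))"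
    by (subst sum.swap) (simp add: mult.commute)
  also have "\<dots> = (\<Sum>j<m. (B * A) $$ (j, j))"
    using assms by (intro sum.cong) (auto simp: scalar_prod_def atLeast0LessThan)
  finally show ?thesis .
qed

lemma proots_linear_factors: "proots (\<Prod>a\<leftarrow>as. [:- a, 1:]) = mset (as :: 'a :: idom list)"
proof (induction as)
  case (Cons a as)
  have "(\<Prod>a\<leftarrow>as. [:- a, 1:]) \<noteq> (0 :: 'a poly)"
    by (auto simp: prod_list_zero_iff)
  thus ?case using Cons by (simp add: proots_mult del: mult_pCons_left)
qed simp

text \<open>By Schur decomposition the matrix is similar to a triangular one, whose diagonal lists
  the eigenvalues with multiplicity. Cyclicity makes the trace invariant under similarity.\<close>

lemma sum_proots_char_poly:
  fixes A :: "complex mat"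
  assumes A: "A \<in> carrier_mat n n"
  shows "sum_mset (proots (char_poly A)) = (\<Sum>i<n. A $$ (i, i))"
proof -
  obtain es where "char_poly A = (\<Prod>a\<leftarrow>es. [:- a, 1:])"
    using char_poly_factorized[OF A] by blast
  then obtain B where B: "B \<in> carrier_mat n n" "upper_triangular B" "similar_mat A B"
    using schur_decomposition_exists[OF A] by blast
  obtain P Q where PQ: "P \<in> carrier_mat n n" "Q \<in> carrier_mat n n"
      "Q * P = 1\<^sub>m n" "A = P * B * Q"
    using similar_matD[OF B(3)] A by fastforce
  have "(\<Sum>i<n. A $$ (i, i)) = (\<Sum>i<n. (P * (B * Q)) $$ (i, i))"
    using PQ B by (simp add: assoc_mult_mat)
  also have "\<dots> = (\<Sum>i<n. (B * Q * P) $$ (i, i))"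
    using PQ B by (intro trace_mult_commute) auto
  also have "B * Q * P = B"
    using PQ B by (simp add: assoc_mult_mat[of _ n n _ n _ n])
  finally have "(\<Sum>i<n. A $$ (i, i)) = sum_list (diag_mat B)"
    using B by (simp add: diag_mat_def sum_list_sum_nth atLeast0LessThan)
  also have "\<dots> = sum_mset (proots (char_poly A))"
    by (simp add: char_poly_similar[OF B(3)] char_poly_upper_triangular[OF B(1,2)]
        proots_linear_factors sum_mset_sum_list)
  finally show ?thesis ..
qed

lemma Re_sum_mset: "Re (sum_mset M) = (\<Sum>z\<in>#M. Re z)"
  by (induction M) auto

text \<open>All eigenvalues are \<open>0\<close> or \<open>c\<close>, and on these two values \<open>eta\<close> is linear.\<close>

lemma vn_entropy_scaled_projection:
  fixes c :: real
  assumes A: "A \<in> carrier_mat n n" and sq: "A * A = complex_of_real c \<cdot>\<^sub>m A" and c: "c \<noteq> 0"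
  shows "vn_entropy A = Re (\<Sum>i<n. A $$ (i, i)) / c * eta c"
proof -
  let ?M = "proots (char_poly A)"
  have "monic (char_poly A)"
    using degree_monic_char_poly[OF A] by simp
  hence nz: "char_poly A \<noteq> 0" by auto
  \<comment> \<open>Applying A^2 = c A to an eigenvector gives \<mu>^2 = c \<mu>.\<close>
  have ev: "\<mu> = 0 \<or> \<mu> = of_real c" if "\<mu> \<in># ?M" for \<mu>
  proof -
    have "eigenvalue A \<mu>"
      using that nz by (simp add: eigenvalue_root_char_poly[OF A])
    then obtain v where v: "v \<in> carrier_vec n" "v \<noteq> 0\<^sub>v n" "A *\<^sub>v v = \<mu> \<cdot>\<^sub>v v"
      using A by (auto simp: eigenvalue_def eigenvector_def)
    have "(A * A) *\<^sub>v v = \<mu> \<cdot>\<^sub>v (\<mu> \<cdot>\<^sub>v v)"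
      using A v by (simp add: assoc_mult_mat_vec mult_mat_vec)
    moreover have "(A * A) *\<^sub>v v = of_real c \<cdot>\<^sub>v (\<mu> \<cdot>\<^sub>v v)"
      using A v(1) by (auto simp: sq smult_scalar_prod_distrib[of _ n] simp flip: v(3))
    ultimately have eq: "\<mu> \<cdot>\<^sub>v (\<mu> \<cdot>\<^sub>v v) = of_real c \<cdot>\<^sub>v (\<mu> \<cdot>\<^sub>v v)" by simp
    obtain i where i: "i < n" "v $ i \<noteq> 0"
      using v by (metis carrier_vecD eq_vecI index_zero_vec(1,2))
    from eq have "(\<mu> \<cdot>\<^sub>v (\<mu> \<cdot>\<^sub>v v)) $ i = (of_real c \<cdot>\<^sub>v (\<mu> \<cdot>\<^sub>v v)) $ i" by simp
    thus ?thesis using i v by simp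
  qed
  \<comment> \<open>Linearity turns the entropy into a multiple of the trace, so multiplicities
    never have to be counted.\<close>
  have "eta (Re \<mu>) = Re \<mu> * (eta c / c)" if "\<mu> \<in># ?M" for \<mu>
    using ev[OF that] c by auto
  hence "vn_entropy A = (\<Sum>\<mu>\<in>#?M. Re \<mu> * (eta c / c))"
    unfolding vn_entropy_def by (intro arg_cong[of _ _ sum_mset] image_mset_cong)
  also have "\<dots> = (\<Sum>\<mu>\<in>#?M. Re \<mu>) * (eta c / c)"
    by (rule sum_mset_distrib_right[symmetric])
  also have "(\<Sum>\<mu>\<in>#?M. Re \<mu>) = Re (sum_mset ?M)"
    by (rule Re_sum_mset[symmetric])
  finally show ?thesis by (simp add: sum_proots_char_poly[OF A])
qed

lemma det_mat_2:
  fixes f :: "nat \<times> nat \<Rightarrow> 'a :: comm_ring_1"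
  shows "det (mat 2 2 f) = f (0, 0) * f (1, 1) - f (0, 1) * f (1, 0)"
  by (subst laplace_expansion_row[of _ 2 0])
     (auto simp: cofactor_def mat_delete_def det_single numeral_2_eq_2)

section \<open>Entropies of the measured states\<close>

lemma sum_div_mod:
  fixes f :: "nat \<Rightarrow> nat \<Rightarrow> 'a :: comm_monoid_add"
  shows "(\<Sum>k<m * n. f (k div n) (k mod n)) = (\<Sum>x<m. \<Sum>y<n. f x y)"
proof (cases "n = 0")
  case False
  have bound: "x * n + y < m * n" if "x < m" "y < n" for x y
    using that mult_le_mono1[of "Suc x" m n] by simp
  have "(\<Sum>x<m. \<Sum>y<n. f x y) = (\<Sum>(x, y)\<in>{..<m} \<times> {..<n}. f x y)"
    by (simp add: sum.cartesian_product)
  also have "(\<Sum>(x, y)\<in>{..<m} \<times> {..<n}. f x y) = (\<Sum>k<m * n. f (k div n) (k mod n))"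
    using False
    by (intro sum.reindex_bij_witness[of _ "\<lambda>k. (k div n, k mod n)" "\<lambda>(x, y). x * n + y"])
       (auto simp: less_mult_imp_div_less bound)
  finally show ?thesis ..
qed simp

lemma complex_mult_cnj_norm: "z * cnj z = complex_of_real ((cmod z)\<^sup>2)"
  by (rule complex_norm_square[symmetric])

context
  fixes dA dB :: nat and psi :: "nat \<Rightarrow> nat \<Rightarrow> complex" and c :: real
  assumes c: "c \<noteq> 0" and rows: "\<And>x. x < dA \<Longrightarrow> (\<Sum>y<dB. (cmod (psi x y))\<^sup>2) = c"
begin

lemma vn_entropy_rho_X: "vn_entropy (rho_X dA dB psi) = dA * eta c"
proof -
  have eq: "rho_X dA dB psi = mat dA dA (\<lambda>(x, x'). if x = x' then complex_of_real c else 0)"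
    by (rule eq_matI) (auto simp: rho_X_def complex_mult_cnj_norm rows simp flip: of_real_sum simp del: of_real_power)
  have "vn_entropy (rho_X dA dB psi) = Re (\<Sum>i<dA. rho_X dA dB psi $$ (i, i)) / c * eta c"
  proof (rule vn_entropy_scaled_projection[OF _ _ c])
    show "rho_X dA dB psi * rho_X dA dB psi = complex_of_real c \<cdot>\<^sub>m rho_X dA dB psi"
      by (rule eq_matI) (auto simp: eq scalar_prod_def if_distrib cong: if_cong)
  qed (simp add: rho_X_def)
  thus ?thesis using c by (simp add: eq)
qed

text \<open>Block x is the rank-one operator of the vector \<open>psi x\<close>, whose squared norm
  is \<open>c\<close>. Its square is thus \<open>c\<close> times itself and its trace is
  \<open>c\<close>.\<close>

lemma vn_entropy_rho_XB: "vn_entropy (rho_XB dA dB psi) = dA * eta c"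
proof -
  let ?R = "rho_XB dA dB psi"
  have "vn_entropy ?R = Re (\<Sum>k<dA * dB. ?R $$ (k, k)) / c * eta c"
  proof (rule vn_entropy_scaled_projection[OF _ _ c])
    show "?R * ?R = complex_of_real c \<cdot>\<^sub>m ?R"
    proof (rule eq_matI)
      fix i j assume "i < dim_row (complex_of_real c \<cdot>\<^sub>m ?R)" "j < dim_col (complex_of_real c \<cdot>\<^sub>m ?R)"
      hence ij: "i < dA * dB" "j < dA * dB" by (auto simp: rho_XB_def)
      have "(?R * ?R) $$ (i, j) = (\<Sum>k<dA * dB. ?R $$ (i, k) * ?R $$ (k, j))"
        using ij by (simp add: rho_XB_def scalar_prod_def atLeast0LessThan)
      \<comment> \<open>The two factors at the middle index k combine to |psi|^2 and leave the (i,
        j) entry; all terms outside the block of i vanish.\<close>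
      also have "\<dots> = (\<Sum>k<dA * dB. ?R $$ (i, j) *
          (if k div dB = i div dB then (cmod (psi (k div dB) (k mod dB)))\<^sup>2 else 0))"
        using ij by (intro sum.cong) (auto simp: rho_XB_def complex_norm_square simp del: of_real_power)
      also have "\<dots> = ?R $$ (i, j) * complex_of_real
          (\<Sum>k<dA * dB. if k div dB = i div dB then (cmod (psi (k div dB) (k mod dB)))\<^sup>2 else 0)"
        by (simp only: sum_distrib_left of_real_sum)
      also have "(\<Sum>k<dA * dB. if k div dB = i div dB then (cmod (psi (k div dB) (k mod dB)))\<^sup>2 else 0)
          = (\<Sum>x<dA. \<Sum>y<dB. if x = i div dB then (cmod (psi x y))\<^sup>2 else 0)"
        by (rule sum_div_mod[where f = "\<lambda>x y. if x = i div dB then (cmod (psi x y))\<^sup>2 else 0"])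
      also have "(\<Sum>x<dA. \<Sum>y<dB. if x = i div dB then (cmod (psi x y))\<^sup>2 else 0)
          = (\<Sum>x<dA. if x = i div dB then c else 0)"
        by (intro sum.cong) (auto simp: rows)
      also have "\<dots> = c"
        using ij by (simp add: less_mult_imp_div_less)
      finally show "(?R * ?R) $$ (i, j) = (complex_of_real c \<cdot>\<^sub>m ?R) $$ (i, j)"
        using ij by (simp add: rho_XB_def)
    qed (simp_all add: rho_XB_def)
  qed (simp add: rho_XB_def)
  also have "(\<Sum>k<dA * dB. ?R $$ (k, k)) =
      complex_of_real (\<Sum>k<dA * dB. (cmod (psi (k div dB) (k mod dB)))\<^sup>2)"
    by (simp add: rho_XB_def complex_mult_cnj_norm)
  also have "(\<Sum>k<dA * dB. (cmod (psi (k div dB) (k mod dB)))\<^sup>2) = dA * c"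
    by (simp add: sum_div_mod[where f = "\<lambda>x y. (cmod (psi x y))\<^sup>2"] rows)
  finally show ?thesis using c by simp
qed

end

context
  fixes dA dB :: nat and psi :: "nat \<Rightarrow> nat \<Rightarrow> complex" and c :: real
  assumes c: "c \<noteq> 0" and cols: "\<And>y. y < dB \<Longrightarrow> (\<Sum>x<dA. (cmod (psi x y))\<^sup>2) = c"
begin

lemma vn_entropy_rho_Y: "vn_entropy (rho_Y dA dB psi) = dB * eta c"
proof -
  have "rho_Y dA dB psi = rho_X dB dA (\<lambda>y x. psi x y)"
    by (simp add: rho_X_def rho_Y_def)
  thus ?thesis by (simp add: vn_entropy_rho_X[OF c] cols)
qed

text \<open>The argument for \<open>rho_XB\<close> with blocks selected by \<open>i mod dB\<close>.
  Exchanging the parties would permute the joint index x*dB + y, so this matrix is not literally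
  \<open>rho_XB\<close> of the transposed amplitudes.\<close>

lemma vn_entropy_rho_AY: "vn_entropy (rho_AY dA dB psi) = dB * eta c"
proof -
  let ?R = "rho_AY dA dB psi"
  have "vn_entropy ?R = Re (\<Sum>k<dA * dB. ?R $$ (k, k)) / c * eta c"
  proof (rule vn_entropy_scaled_projection[OF _ _ c])
    show "?R * ?R = complex_of_real c \<cdot>\<^sub>m ?R"
    proof (rule eq_matI)
      fix i j assume "i < dim_row (complex_of_real c \<cdot>\<^sub>m ?R)" "j < dim_col (complex_of_real c \<cdot>\<^sub>m ?R)"
      hence ij: "i < dA * dB" "j < dA * dB" by (auto simp: rho_AY_def)
      have "(?R * ?R) $$ (i, j) = (\<Sum>k<dA * dB. ?R $$ (i, k) * ?R $$ (k, j))"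
        using ij by (simp add: rho_AY_def scalar_prod_def atLeast0LessThan)
      also have "\<dots> = (\<Sum>k<dA * dB. ?R $$ (i, j) *
          (if k mod dB = i mod dB then (cmod (psi (k div dB) (k mod dB)))\<^sup>2 else 0))"
        using ij by (intro sum.cong) (auto simp: rho_AY_def complex_norm_square simp del: of_real_power)
      also have "\<dots> = ?R $$ (i, j) * complex_of_real
          (\<Sum>k<dA * dB. if k mod dB = i mod dB then (cmod (psi (k div dB) (k mod dB)))\<^sup>2 else 0)"
        by (simp only: sum_distrib_left of_real_sum)
      also have "(\<Sum>k<dA * dB. if k mod dB = i mod dB then (cmod (psi (k div dB) (k mod dB)))\<^sup>2 else 0)
          = (\<Sum>x<dA. \<Sum>y<dB. if y = i mod dB then (cmod (psi x y))\<^sup>2 else 0)"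
        by (rule sum_div_mod[where f = "\<lambda>x y. if y = i mod dB then (cmod (psi x y))\<^sup>2 else 0"])
      also have "(\<Sum>x<dA. \<Sum>y<dB. if y = i mod dB then (cmod (psi x y))\<^sup>2 else 0) = c"
        using ij by (cases "dB = 0") (auto simp: cols)
      finally show "(?R * ?R) $$ (i, j) = (complex_of_real c \<cdot>\<^sub>m ?R) $$ (i, j)"
        using ij by (simp add: rho_AY_def)
    qed (simp_all add: rho_AY_def)
  qed (simp add: rho_AY_def)
  also have "(\<Sum>k<dA * dB. ?R $$ (k, k)) =
      complex_of_real (\<Sum>k<dA * dB. (cmod (psi (k div dB) (k mod dB)))\<^sup>2)"
    by (simp add: rho_AY_def complex_mult_cnj_norm)
  also have "(\<Sum>k<dA * dB. (cmod (psi (k div dB) (k mod dB)))\<^sup>2) = (\<Sum>y<dB. \<Sum>x<dA. (cmod (psi x y))\<^sup>2)"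
    by (subst sum.swap) (rule sum_div_mod)
  also have "\<dots> = dB * c"
    by (simp add: cols)
  finally show ?thesis using c by simp
qed

end

section \<open>Spectrum of a weighted 4-cycle\<close>

lemma sum_lessThan_4: "(\<Sum>x<4. f x) = f 0 + f 1 + f 2 + f (3::nat)"
  by (simp add: eval_nat_numeral)

lemma less_2: "i < 2 \<longleftrightarrow> i = 0 \<or> i = (1::nat)"
  by auto

lemma less_4: "i < 4 \<longleftrightarrow> i = 0 \<or> i = 1 \<or> i = 2 \<or> i = (3::nat)"
  by auto

lemma sum_0_2: "(\<Sum>i=0..<2. f i) = f 0 + f (1::nat)"
  by (simp add: numeral_2_eq_2)

lemma linear_factors_pm:
  "[:- complex_of_real ((1 + c) / 4), 1:] * [:- complex_of_real ((1 - c) / 4), 1:]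
     = [:(1 - (complex_of_real c)\<^sup>2) / 16, - 1 / 2, 1:]"
  by (simp add: field_simps power2_eq_square)

lemma vn_entropy_quarter_pairs:
  fixes c s :: real
  assumes "char_poly \<rho> = [:(1 - (complex_of_real c)\<^sup>2) / 16, - 1 / 2, 1:]
    * [:(1 - (complex_of_real s)\<^sup>2) / 16, - 1 / 2, 1:]"
  shows "vn_entropy \<rho> = eta ((1 + c) / 4) + eta ((1 - c) / 4) + (eta ((1 + s) / 4) + eta ((1 - s) / 4))"
proof -
  have "char_poly \<rho> = (\<Prod>a\<leftarrow>[(1 + c) / 4, (1 - c) / 4, (1 + s) / 4, (1 - s) / 4]. [:- complex_of_real a, 1:])"
    by (simp only: assms linear_factors_pm[symmetric] list.map prod_list.Cons prod_list.Nil
        mult_1_right mult.assoc)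
  also have "\<dots> = (\<Prod>a\<leftarrow>map complex_of_real [(1 + c) / 4, (1 - c) / 4, (1 + s) / 4, (1 - s) / 4]. [:- a, 1:])"
    by (simp only: map_map o_def)
  finally have "proots (char_poly \<rho>) = mset (map complex_of_real [(1 + c) / 4, (1 - c) / 4, (1 + s) / 4, (1 - s) / 4])"
    by (simp only: proots_linear_factors)
  thus ?thesis by (simp add: vn_entropy_def del: of_real_divide of_real_add of_real_diff)
qed

text \<open>Let K be the upper right block. Eliminating the scalar diagonal blocks leaves the
  determinant of (x - 1/4)^2 - K K*, and K K* has diagonal entries 1/32 and off-diagonal modulus
  t/32, hence eigenvalues (1 + t)/32 and (1 - t)/32. The factors are kept quadratic so that no
  square roots enter yet.\<close>

lemma char_poly_four_cycle:
  fixes p q r s :: complex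
  assumes M: "M = mat 4 4 (\<lambda>(i, j). [[1/4, 0, p, q], [0, 1/4, r, s],
      [cnj p, cnj r, 1/4, 0], [cnj q, cnj s, 0, 1/4]] ! i ! j)"
    and n: "cmod p = 1/8" "cmod q = 1/8" "cmod r = 1/8" "cmod s = 1/8"
  defines "t \<equiv> 32 * cmod (p * cnj r + q * cnj s)"
  shows "char_poly M = [:(1 - (1 + complex_of_real t) / 2) / 16, - 1 / 2, 1:]
    * [:(1 - (1 - complex_of_real t) / 2) / 16, - 1 / 2, 1:]"
proof -
  let ?a = "[:- 1/4, 1:] :: complex poly"
  let ?D = "mat 2 2 (\<lambda>(i, j). if i = j then ?a else 0)"
  let ?B = "mat 2 2 (\<lambda>(i, j). [[[:- p:], [:- q:]], [[:- r:], [:- s:]]] ! i ! j)"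
  let ?C = "mat 2 2 (\<lambda>(i, j). [[[:- cnj p:], [:- cnj r:]], [[:- cnj q:], [:- cnj s:]]] ! i ! j)"
  have "char_poly_matrix M = four_block_mat ?D ?B ?C ?D"
    by (rule eq_matI) (auto simp: M char_poly_matrix_def less_4)
  \<comment> \<open>The block determinant formula applies because \<open>?D\<close> is scalar and
    commutes with \<open>?C\<close>.\<close>
  hence "char_poly M = det (?D * ?D - ?B * ?C)"
    unfolding char_poly_def
    by (simp, subst det_four_block_mat[where n = 2])
       (auto intro!: eq_matI simp: scalar_prod_def less_2 sum_0_2)
  also have "?D * ?D - ?B * ?C = mat 2 2 (\<lambda>(i, j). [[?a * ?a - [:p * cnj p + q * cnj q:], [:- (p * cnj r + q * cnj s):]],
      [[:- (r * cnj p + s * cnj q):], ?a * ?a - [:r * cnj r + s * cnj s:]]] ! i ! j)"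
    by (auto intro!: eq_matI simp: scalar_prod_def less_2 sum_0_2)
  also have "det \<dots> = (?a * ?a - [:1/32:]) * (?a * ?a - [:1/32:]) - [:(p * cnj r + q * cnj s) * cnj (p * cnj r + q * cnj s):]"
    by (simp add: det_mat_2 complex_mult_cnj_norm n power2_eq_square) (simp add: algebra_simps)
  also have "(p * cnj r + q * cnj s) * cnj (p * cnj r + q * cnj s) = (complex_of_real t / 32)\<^sup>2"
    unfolding complex_mult_cnj_norm by (simp add: t_def)
  \<comment> \<open>A difference of squares, split into the factors (x - 1/4)^2 - (1 + t)/32 and (x
    - 1/4)^2 - (1 - t)/32.\<close>
  also have "(?a * ?a - [:1/32:]) * (?a * ?a - [:1/32:]) - [:(complex_of_real t / 32)\<^sup>2:] =
      [:(1 - (1 + complex_of_real t) / 2) / 16, - 1 / 2, 1:]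
    * [:(1 - (1 - complex_of_real t) / 2) / 16, - 1 / 2, 1:]"
    by (simp add: field_simps power2_eq_square)
  finally show ?thesis .
qed

text \<open>The bounds from \<open>eta_pair_ge\<close> add up to 2 - (c^2 + d^2)/2 = 3/2 for every
  t, that is, for all phases.\<close>

lemma vn_entropy_four_cycle_ge:
  fixes p q r s :: complex
  assumes M: "M = mat 4 4 (\<lambda>(i, j). [[1/4, 0, p, q], [0, 1/4, r, s],
      [cnj p, cnj r, 1/4, 0], [cnj q, cnj s, 0, 1/4]] ! i ! j)"
    and n: "cmod p = 1/8" "cmod q = 1/8" "cmod r = 1/8" "cmod s = 1/8"
  shows "vn_entropy M \<ge> 3/2"
proof -
  define t where "t = 32 * cmod (p * cnj r + q * cnj s)"
  define c d where "c = sqrt ((1 + t) / 2)" and "d = sqrt ((1 - t) / 2)"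
  \<comment> \<open>This gives t \<le> 1, so that \<open>d\<close> is a genuine square root and both
    \<open>c\<close> and \<open>d\<close> lie in [0, 1].\<close>
  have "cmod (p * cnj r + q * cnj s) \<le> 1/32"
    by (rule order.trans[OF norm_triangle_ineq]) (simp add: norm_mult n)
  hence t: "0 \<le> t" "t \<le> 1" by (simp_all add: t_def)
  have sq: "c\<^sup>2 = (1 + t) / 2" "d\<^sup>2 = (1 - t) / 2"
    using t by (simp_all add: c_def d_def)
  have "char_poly M = [:(1 - (complex_of_real c)\<^sup>2) / 16, - 1 / 2, 1:]
    * [:(1 - (complex_of_real d)\<^sup>2) / 16, - 1 / 2, 1:]"
    using char_poly_four_cycle[OF M n] by (simp add: sq t_def flip: of_real_power)
  hence "vn_entropy M = eta ((1 + c) / 4) + eta ((1 - c) / 4) + (eta ((1 + d) / 4) + eta ((1 - d) / 4))"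
    by (rule vn_entropy_quarter_pairs)
  also have "\<dots> \<ge> (1 - c\<^sup>2 / 2) + (1 - d\<^sup>2 / 2)"
    using t by (intro add_mono eta_pair_ge) (auto simp: c_def d_def)
  finally show ?thesis by (simp add: sq field_simps)
qed

text \<open>The extreme case c = 1, s = 0, with roots 1/2, 0, 1/4, 1/4.\<close>

lemma vn_entropy_canonical:
  assumes "char_poly \<rho> = [:0, - 1 / 2, 1:] * [:1 / 16, - 1 / 2, 1:]"
  shows "vn_entropy \<rho> = 3/2"
proof -
  have "char_poly \<rho> = [:(1 - (complex_of_real 1)\<^sup>2) / 16, - 1 / 2, 1:]
    * [:(1 - (complex_of_real 0)\<^sup>2) / 16, - 1 / 2, 1:]"
    using assms by simp
  from vn_entropy_quarter_pairs[OF this] show ?thesis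
    using eta_half[of 1] by (simp add: eta_quarter)
qed

section \<open>Reduced states of a regular embedding\<close>

context
  fixes \<theta> :: "nat \<Rightarrow> nat \<Rightarrow> real" and psi
  defines "psi \<equiv> regular_embedding \<theta> P_OT"
begin

lemma cmod_sq_psi: "(cmod (psi x y))\<^sup>2 = P_OT x y"
  by (simp add: psi_def regular_embedding_def norm_mult P_OT_def)

lemma row_sum_psi: "x < 4 \<Longrightarrow> (\<Sum>y<4. (cmod (psi x y))\<^sup>2) = 1/4"
  by (auto simp: cmod_sq_psi less_4 sum_lessThan_4 P_OT_def bit_of_def)

lemma col_sum_psi: "y < 4 \<Longrightarrow> (\<Sum>x<4. (cmod (psi x y))\<^sup>2) = 1/4"
  by (auto simp: cmod_sq_psi less_4 sum_lessThan_4 P_OT_def bit_of_def)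

lemma shannon_MI_psi: "shannon_MI 4 4 (prob_XY psi) = 1"
proof -
  have "shannon 4 (\<lambda>x. \<Sum>y<4. prob_XY psi x y) = 2" "shannon 4 (\<lambda>y. \<Sum>x<4. prob_XY psi x y) = 2"
    by (simp_all add: shannon_def prob_XY_def row_sum_psi col_sum_psi eta_quarter)
  \<comment> \<open>Eight outcomes of probability 1/8 contribute 3/8 each.\<close>
  moreover have "shannon (4 * 4) (\<lambda>k. prob_XY psi (k div 4) (k mod 4)) = 3"
    unfolding shannon_def sum_div_mod[where f = "\<lambda>x y. eta (prob_XY psi x y)"]
    by (simp add: prob_XY_def cmod_sq_psi sum_lessThan_4 P_OT_def bit_of_def eta_eighth)
  ultimately show ?thesis by (simp add: shannon_MI_def)
qed

text \<open>The entropies of X and XB are equal and cancel, so S(X;B) = S(B); likewise S(A;Y) =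
  S(A).\<close>

lemma leakage_psi: "leakage 4 4 psi = max (vn_entropy (rho_B 4 4 psi)) (vn_entropy (rho_A 4 4 psi)) - 1"
  using vn_entropy_rho_X[where psi = psi and dA = 4 and dB = 4, OF _ row_sum_psi]
    vn_entropy_rho_XB[where psi = psi and dA = 4 and dB = 4, OF _ row_sum_psi]
    vn_entropy_rho_Y[where psi = psi and dA = 4 and dB = 4, OF _ col_sum_psi]
    vn_entropy_rho_AY[where psi = psi and dA = 4 and dB = 4, OF _ col_sum_psi]
  by (simp add: leakage_def qMI_XB_def qMI_AY_def shannon_MI_psi)

text \<open>Two of Bob's outcomes with the same choice c and different bits share no x, which gives
  the zeros. Outcomes with different choices fix both bits of x, so each such entry is a single
  product.\<close>

lemma rho_B_psi:
  "rho_B 4 4 psi = mat 4 4 (\<lambda>(i, j).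
     [[1/4, 0, psi 0 0 * cnj (psi 0 2), psi 1 0 * cnj (psi 1 3)],
      [0, 1/4, psi 2 1 * cnj (psi 2 2), psi 3 1 * cnj (psi 3 3)],
      [cnj (psi 0 0 * cnj (psi 0 2)), cnj (psi 2 1 * cnj (psi 2 2)), 1/4, 0],
      [cnj (psi 1 0 * cnj (psi 1 3)), cnj (psi 3 1 * cnj (psi 3 3)), 0, 1/4]] ! i ! j)"
proof -
  have zero: "psi x y = 0" if "P_OT x y = 0" for x y
    using cmod_sq_psi[of x y] that by simp
  have eighth: "psi x y * cnj (psi x y) = 1/8" if "P_OT x y = 1/8" for x y
    by (simp add: complex_mult_cnj_norm cmod_sq_psi that del: of_real_power)
  show ?thesis
    by (rule eq_matI,
        simp_all only: rho_B_def dim_row_mat dim_col_mat index_mat less_4 prod.case sum_lessThan_4,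
        elim disjE)
       (simp_all add: P_OT_def bit_of_def zero eighth)
qed

lemma cmod_psi: "P_OT x y = 1/8 \<Longrightarrow> cmod (psi x y) = sqrt (1/8)"
  using cmod_sq_psi[of x y] by (metis norm_ge_zero real_sqrt_unique)

lemma vn_entropy_rho_B_psi_ge: "vn_entropy (rho_B 4 4 psi) \<ge> 3/2"
  by (rule vn_entropy_four_cycle_ge[OF rho_B_psi])
     (simp_all add: norm_mult cmod_psi P_OT_def bit_of_def)

end

section \<open>The canonical embedding\<close>

lemma canonical_apply: "regular_embedding (\<lambda>_ _. 0) P_OT x y = complex_of_real (sqrt (P_OT x y))"
  by (simp add: regular_embedding_def)

lemma sqrt_eighth_mult: "complex_of_real (sqrt (1/8)) * complex_of_real (sqrt (1/8)) = 1/8"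
  by (simp flip: of_real_mult)

text \<open>All four products equal 1/8, so the two terms inside the modulus align and t = 1 in
  \<open>char_poly_four_cycle\<close>.\<close>

lemma vn_entropy_rho_B_canonical: "vn_entropy (rho_B 4 4 (regular_embedding (\<lambda>_ _. 0) P_OT)) = 3/2"
proof (rule vn_entropy_canonical)
  have [simp]: "regular_embedding (\<lambda>_ _. 0) P_OT x y * cnj (regular_embedding (\<lambda>_ _. 0) P_OT x y') = 1/8"
    if "P_OT x y = 1/8" "P_OT x y' = 1/8" for x y y'
    unfolding canonical_apply that complex_cnj_complex_of_real by (rule sqrt_eighth_mult)
  show "char_poly (rho_B 4 4 (regular_embedding (\<lambda>_ _. 0) P_OT)) = [:0, - 1 / 2, 1:] * [:1 / 16, - 1 / 2, 1:]"
    by (subst char_poly_four_cycle[OF rho_B_psi])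
       (simp_all add: P_OT_def bit_of_def del: complex_cnj_mult)
qed

text \<open>Alice's indices form the cycle 0, 1, 3, 2, which does not match the ordering in
  \<open>char_poly_four_cycle\<close>. The blocks here are split by the first bit, and now the
  off-diagonal block \<open>?B\<close> is the scalar one.\<close>

lemma vn_entropy_rho_A_canonical: "vn_entropy (rho_A 4 4 (regular_embedding (\<lambda>_ _. 0) P_OT)) = 3/2"
proof (rule vn_entropy_canonical)
  let ?M = "rho_A 4 4 (regular_embedding (\<lambda>_ _. 0) P_OT)"
  let ?a = "[:- 1/4, 1:] :: complex poly"
  let ?D = "mat 2 2 (\<lambda>(i, j). if i = j then ?a else [:- 1/8:])"
  let ?B = "mat 2 2 (\<lambda>(i, j). if i = j then [:- 1/8:] else 0) :: complex poly mat"
  have "?M = mat 4 4 (\<lambda>(i, j). [[1/4, 1/8, 1/8, 0], [1/8, 1/4, 0, 1/8], [1/8, 0, 1/4, 1/8], [0, 1/8, 1/8, 1/4]] ! i ! j)"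
    by (rule eq_matI,
        simp_all only: rho_A_def dim_row_mat dim_col_mat index_mat less_4 prod.case sum_lessThan_4 canonical_apply,
        elim disjE)
       (simp_all add: P_OT_def bit_of_def sqrt_eighth_mult)
  hence "char_poly_matrix ?M = four_block_mat ?D ?B ?B ?D"
    by (intro eq_matI) (auto simp: char_poly_matrix_def less_4)
  hence "char_poly ?M = det (?D * ?D - ?B * ?B)"
    unfolding char_poly_def
    by (simp, subst det_four_block_mat[where n = 2])
       (auto intro!: eq_matI simp: scalar_prod_def less_2 sum_0_2)
  also have "?D * ?D - ?B * ?B = mat 2 2 (\<lambda>(i, j). if i = j then ?a * ?a else [:1/16, - 1/4:])"
    by (auto intro!: eq_matI simp: scalar_prod_def less_2 sum_0_2)
  also have "det \<dots> = [:0, - 1 / 2, 1:] * [:1 / 16, - 1 / 2, 1:]"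
    by (simp add: det_mat_2)
  finally show "char_poly ?M = [:0, - 1 / 2, 1:] * [:1 / 16, - 1 / 2, 1:]" .
qed

theorem theorem7:
  shows "(\<forall>\<theta>. leakage 4 4 (regular_embedding \<theta> P_OT) \<ge> 1/2) \<and>
         (\<forall>\<theta>. leakage 4 4 (regular_embedding (\<lambda>_ _. 0) P_OT)
                \<le> leakage 4 4 (regular_embedding \<theta> P_OT))"
proof -
  \<comment> \<open>The leakage is a maximum, so the bound on S(B) alone suffices.\<close>
  have "leakage 4 4 (regular_embedding \<theta> P_OT) \<ge> 1/2" for \<theta>
    using vn_entropy_rho_B_psi_ge[of \<theta>] by (simp add: leakage_psi)
  moreover have "leakage 4 4 (regular_embedding (\<lambda>_ _. 0) P_OT) = 1/2"
    by (simp add: leakage_psi vn_entropy_rho_B_canonical vn_entropy_rho_A_canonical)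
  ultimately show ?thesis by metis
qed

end
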